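(* Let $m=q\geq 2$ be integers. For every integer $k\ge 0$, set $B = m^{k+1}-m^k - m^{k-1} - \cdots - m$ (so $B=m$ when $k=0$). Then $M^k(MR)^B R^k$ generates a self-conjugate CMP of $m^{B+k+1}$.
   Context: Let $m\ge 2$ be an integer. A partition $\lambda$ of a positive integer is $m$-ary if all its parts are powers $m^i$, $i\ge 0$ (so $m^0=1$ is allowed). If $a_i$ is the number of times the part $m^i$ appears in $\lambda$, one writes $\lambda=(a_k,a_{k-1},\ldots,a_0)_m$, where $a_k\neq 0$ and $a_i=0$ for $i>k$. A CMP (conjugate $m$-ary partition, i.e. conjugate $(m,m)$-ary partition) is an $m$-ary partition $\lambda$ whose conjugate $\lambda'$ is also $m$-ary; it is self-conjugate if $\lambda=\lambda'$. On CMPs $\lambda=(a_k,\ldots,a_0)_m$ define the operators (each producing a CMP; here $q=m$): raise $R(\lambda)=(ma_k,\ldots,ma_0)_m$ and migration $M(\lambda)=(1,a_k-1,a_{k-1},\ldots,a_0)_m$. Sequences of operators are composed as functions (rightmost applied first); a sequence $A$ generates the partition $A(1)_m$, where $(1)_m$ is the trivial partition of $1$. *)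

theory Defs
  imports Main "HOL-Library.Multiset"
begin

definition is_partition :: "nat multiset \<Rightarrow> bool" where
  "is_partition \<mu> \<longleftrightarrow> \<mu> \<noteq> {#} \<and> 0 \<notin># \<mu>"

definition partition_of :: "nat multiset \<Rightarrow> nat \<Rightarrow> bool" where
  "partition_of \<mu> n \<longleftrightarrow> is_partition \<mu> \<and> sum_mset \<mu> = n"

text \<open>The \<open>j\<close>-th part of the conjugate is the number of parts that are at least \<open>j\<close>, where \<open>j\<close> runs
  from 1 to the largest part.\<close>

definition conjugate :: "nat multiset \<Rightarrow> nat multiset" where
  "conjugate \<mu> = {# size {# p \<in># \<mu>. j \<le> p #}. j \<in># mset_set {j. 1 \<le> j \<and> (\<exists>p\<in>#\<mu>. j \<le> p)} #}"

definition m_ary :: "nat \<Rightarrow> nat multiset \<Rightarrow> bool" where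
  "m_ary m \<mu> \<longleftrightarrow> is_partition \<mu> \<and> (\<forall>p\<in>#\<mu>. \<exists>i. p = m ^ i)"

definition CMP :: "nat \<Rightarrow> nat multiset \<Rightarrow> bool" where
  "CMP m \<mu> \<longleftrightarrow> m_ary m \<mu> \<and> m_ary m (conjugate \<mu>)"

text \<open>\<open>of_mults m [a\<^sub>k, \<dots>, a\<^sub>0]\<close> is the partition \<open>(a\<^sub>k, \<dots>, a\<^sub>0)\<^sub>m\<close>, with the multiplicity of the
  largest part at the head. Conversely, \<open>mults m \<mu>\<close> is the list \<open>[a\<^sub>k, \<dots>, a\<^sub>0]\<close> of multiplicities of
  an \<open>m\<close>-ary partition, where \<open>k\<close> is the largest exponent that occurs, so \<open>a\<^sub>k \<noteq> 0\<close>.\<close>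

primrec of_mults :: "nat \<Rightarrow> nat list \<Rightarrow> nat multiset" where
  "of_mults m [] = {#}"
| "of_mults m (a # as) = replicate_mset a (m ^ length as) + of_mults m as"

definition mults :: "nat \<Rightarrow> nat multiset \<Rightarrow> nat list" where
  "mults m \<mu> = map (\<lambda>i. count \<mu> (m ^ i)) (rev [0..<Suc (Max {i. m ^ i \<in># \<mu>})])"

text \<open>The operators are total functions; they are only meaningful on \<open>m\<close>-ary partitions with
  \<open>m \<ge> 2\<close>, where \<open>raise_of_mults\<close> and \<open>migrate_of_mults\<close> below describe them.\<close>

definition raise :: "nat \<Rightarrow> nat multiset \<Rightarrow> nat multiset" where
  "raise m \<mu> = of_mults m (map (\<lambda>a. m * a) (mults m \<mu>))"

definition migrate :: "nat \<Rightarrow> nat multiset \<Rightarrow> nat multiset" where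
  "migrate m \<mu> = of_mults m (1 # (hd (mults m \<mu>) - 1) # tl (mults m \<mu>))"

lemma count_of_mults:
  assumes "m \<ge> 2"
  shows "count (of_mults m as) (m ^ i) = (if i < length as then rev as ! i else 0)"
  using assms by (induction as) (auto simp: nth_append)

lemma mults_of_mults:
  assumes m: "m \<ge> 2" and a: "a \<noteq> 0"
  shows "mults m (of_mults m (a # as)) = a # as"
proof -
  let ?S = "{i. m ^ i \<in># of_mults m (a # as)}"
  have "m ^ i \<in># of_mults m (a # as) \<longleftrightarrow> i < Suc (length as) \<and> rev (a # as) ! i \<noteq> 0" for i
    unfolding count_greater_zero_iff[symmetric] count_of_mults[OF m] by simp
  then have S: "?S = {i. i < Suc (length as) \<and> rev (a # as) ! i \<noteq> 0}" by blast
  have fin: "finite ?S"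
    unfolding S by simp
  have "length as \<in> ?S"
    unfolding S using a by (simp add: nth_append)
  moreover have "i \<le> length as" if "i \<in> ?S" for i
    using that unfolding S by simp
  ultimately have mx: "Max ?S = length as"
    using fin by (intro Max_eqI)
  show ?thesis
  proof (rule nth_equalityI)
    fix j assume "j < length (mults m (of_mults m (a # as)))"
    then have j: "j < Suc (length as)" unfolding mults_def mx by simp
    then show "mults m (of_mults m (a # as)) ! j = (a # as) ! j"
      unfolding mults_def mx count_of_mults[OF m]
      by (auto simp: rev_nth le_imp_less_Suc simp del: rev.simps upt_Suc)
  qed (simp only: mults_def mx length_map length_rev length_upt list.size diff_zero add_0_right add_Suc_right)
qed

lemma of_mults_mults:
  assumes m: "m \<ge> 2" and "m_ary m \<mu>"
  shows "of_mults m (mults m \<mu>) = \<mu>" and "hd (mults m \<mu>) \<noteq> 0"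
proof -
  let ?S = "{i. m ^ i \<in># \<mu>}"
  have inj: "inj (\<lambda>i. m ^ i)" using m by (auto intro!: injI)
  have fin: "finite ?S"
    using finite_vimageI[OF finite_set_mset[of \<mu>] inj] by (simp add: vimage_def)
  have ne: "?S \<noteq> {}" using assms(2) by (fastforce simp: m_ary_def is_partition_def)
  have "Max ?S \<in> ?S" using Max_in[OF fin ne] .
  then show "hd (mults m \<mu>) \<noteq> 0" by (simp add: mults_def)
  have powr: "p \<in># of_mults m as \<Longrightarrow> \<exists>i. p = m ^ i" for p as
    by (induction as) (auto split: if_splits)
  show "of_mults m (mults m \<mu>) = \<mu>"
  proof (rule multiset_eqI)
    fix p
    show "count (of_mults m (mults m \<mu>)) p = count \<mu> p"
    proof (cases "\<exists>i. p = m ^ i")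
      case True
      then obtain i where p: "p = m ^ i" by blast
      have "i \<notin> ?S" if "i > Max ?S" using that Max_ge[OF fin, of i] by auto
      then have "count \<mu> (m ^ i) = 0" if "i > Max ?S" using that by (simp add: not_in_iff)
      then show ?thesis unfolding p count_of_mults[OF m]
        by (auto simp: mults_def rev_map not_less_eq nth_append less_Suc_eq simp del: upt_Suc)
    next
      case False
      then have "p \<notin># of_mults m (mults m \<mu>)" "p \<notin># \<mu>"
        using powr assms(2) by (auto simp: m_ary_def)
      then show ?thesis by (simp add: not_in_iff)
    qed
  qed
qed

lemma raise_of_mults:
  assumes "m \<ge> 2" "a \<noteq> 0"
  shows "raise m (of_mults m (a # as)) = of_mults m (map (\<lambda>a. m * a) (a # as))"
  unfolding raise_def mults_of_mults[OF assms] ..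

lemma migrate_of_mults:
  assumes "m \<ge> 2" "a \<noteq> 0"
  shows "migrate m (of_mults m (a # as)) = of_mults m (1 # (a - 1) # as)"
  unfolding migrate_def mults_of_mults[OF assms] by simp

text \<open>The exponent \<open>B = m^(k+1) - m^k - \<dots> - m\<close> is positive, so the subtraction on naturals does not
  truncate.\<close>

lemma sum_powers_less:
  assumes "m \<ge> (2::nat)"
  shows "(\<Sum>i=1..k. m ^ i) < m ^ (k + 1)"
proof (induction k)
  case (Suc k)
  have "(\<Sum>i=1..Suc k. m ^ i) < m ^ (k + 1) + m ^ (k + 1)" using Suc by simp
  also have "\<dots> \<le> m ^ (Suc k + 1)" using mult_right_mono[OF assms, of "m ^ (k + 1)"] unfolding mult_2 by (simp del: mult_le_cancel2)
  finally show ?case .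
qed (use assms in simp)

end

theory Submission imports Defs begin

text \<open>The operators can be traced on multiplicity lists. Starting from \<open>m ^ k\<close> ones, the iterates of
  \<open>M R\<close> build up a list whose partial sums from the left are \<open>1, m, \<dots>, m ^ c, m ^ (c + k + 1)\<close>, where
  \<open>c = B - 1\<close>, and the final migrations only insert zeros behind the leading 1. The result is the
  partition \<open>staircase\<close> below. Exactly \<open>m ^ (c + 1 - i)\<close> of its parts are at least \<open>m ^ i\<close>, for \<open>1 \<le> i \<le> c\<close>, so the
  outer corners of its Young diagram include the points with coordinates \<open>m ^ i\<close> and
  \<open>m ^ (c + 1 - i)\<close>. Reflection in the diagonal replaces \<open>i\<close> by \<open>c + 1 - i\<close> and permutes them. The
  only other corners are the ends of the first row and the first column, and these have the same
  length \<open>m ^ (c + k + 1)\<close>. So the partition is self-conjugate for every \<open>c\<close> and \<open>k\<close>. In the proof,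
  \<open>conjugate_powers\<close> and \<open>staircase_count_ge\<close> carry this out for the multiset of parts.

  The value of \<open>B\<close> matters only for the size. Each of the \<open>c\<close> middle blocks of equal parts has sum
  \<open>(m - 1) m ^ c\<close>, so the total is \<open>2 m ^ (c + k + 1) + c (m - 1) m ^ c - m ^ c\<close>. This equals
  \<open>m ^ (c + k + 2)\<close> exactly when \<open>(m - 1) c = m ^ (k + 2) - 2 m ^ (k + 1) + 1\<close>, which is the equation
  that \<open>B = m ^ (k + 1) - m ^ k - \<dots> - m\<close> solves, by the geometric sum.\<close>

section \<open>Conjugates of partitions into powers\<close>

lemma sum_power_diff_telescope:
  fixes m :: nat
  assumes "m \<ge> 1"
  shows "(\<Sum>i<n. m ^ (a + i + 1) - m ^ (a + i)) = m ^ (a + n) - m ^ a"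
proof (induction n)
  case (Suc n)
  have "m ^ a \<le> m ^ (a + n)" "m ^ (a + n) \<le> m ^ (a + Suc n)"
    using assms by (auto intro!: power_increasing)
  then show ?case using Suc by simp
qed simp

lemma sum_replicate_mset: "(\<Sum>i<(n::nat). replicate_mset (f i) x) = replicate_mset (\<Sum>i<n. f i) x"
  by (induction n) (simp_all add: multiset_eq_iff)

lemma filter_replicate_mset_if:
  "filter_mset P (replicate_mset n x) = (if P x then replicate_mset n x else {#})"
  by (induction n) simp_all

lemma image_mset_power_blocks:
  fixes m :: nat
  assumes "m \<ge> 1"
    and const: "\<And>i j. i < n \<Longrightarrow> m ^ i < j \<Longrightarrow> j \<le> m ^ (i + 1) \<Longrightarrow> f j = f (m ^ (i + 1))"
  shows "image_mset f (mset_set {1..m ^ n})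
    = {#f 1#} + (\<Sum>i<n. replicate_mset (m ^ (i + 1) - m ^ i) (f (m ^ (i + 1))))"
  using const
proof (induction n)
  case (Suc n)
  let ?I = "{m ^ n<..m ^ (n + 1)}"
  have le: "1 \<le> m ^ n" "m ^ n \<le> m ^ (n + 1)" using assms(1) by simp_all
  have split: "{1..m ^ Suc n} = {1..m ^ n} \<union> ?I"
    using ivl_disj_un_two(8)[of 1 "m ^ n" "m ^ (n + 1)"] le by simp
  have "image_mset f (mset_set ?I) = image_mset (\<lambda>_. f (m ^ (n + 1))) (mset_set ?I)"
    by (rule image_mset_cong) (use Suc.prems[of n] in auto)
  also have "\<dots> = replicate_mset (m ^ (n + 1) - m ^ n) (f (m ^ (n + 1)))"
    by (simp add: image_mset_const_eq)
  finally have "image_mset f (mset_set ?I)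
      = replicate_mset (m ^ (n + 1) - m ^ n) (f (m ^ (n + 1)))" .
  moreover have "mset_set {1..m ^ Suc n} = mset_set {1..m ^ n} + mset_set ?I"
    unfolding split by (rule mset_set_Union) auto
  ultimately show ?case using Suc by simp
qed simp

text \<open>If all parts are powers of \<open>m\<close>, the number of parts that are at least \<open>j\<close> changes only when
  \<open>j\<close> passes a power of \<open>m\<close>, so the conjugate falls into one block of equal parts for each exponent.\<close>

lemma conjugate_powers:
  fixes m :: nat
  assumes m: "m \<ge> 2"
    and powers: "\<And>p. p \<in># \<mu> \<Longrightarrow> \<exists>i\<le>n. p = m ^ i"
    and top: "m ^ n \<in># \<mu>"
  shows "conjugate \<mu> = {#size \<mu>#}
    + (\<Sum>i<n. replicate_mset (m ^ (i + 1) - m ^ i) (size {#p \<in># \<mu>. m ^ (i + 1) \<le> p#}))"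
proof -
  let ?N = "\<lambda>j. size {#p \<in># \<mu>. j \<le> p#}"
  have le: "p \<le> m ^ n" if "p \<in># \<mu>" for p
    using powers[OF that] m by (auto intro: power_increasing)
  have pos: "1 \<le> p" if "p \<in># \<mu>" for p
    using powers[OF that] m by auto
  have range: "{j. 1 \<le> j \<and> (\<exists>p\<in>#\<mu>. j \<le> p)} = {1..m ^ n}"
    using top by (auto dest: le intro: le_trans)
  have all: "?N 1 = size \<mu>"
    using pos by (metis (mono_tags, lifting) filter_mset_True filter_mset_cong)
  have const: "?N j = ?N (m ^ (i + 1))" if "m ^ i < j" "j \<le> m ^ (i + 1)" for i j
  proof -
    have "j \<le> p \<longleftrightarrow> m ^ (i + 1) \<le> p" if "p \<in># \<mu>" for p
    proof
      assume "j \<le> p"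
      obtain e where e: "p = m ^ e" using powers \<open>p \<in># \<mu>\<close> by blast
      have "m ^ i < m ^ e" using \<open>m ^ i < j\<close> \<open>j \<le> p\<close> e by simp
      then have "i < e" using m by simp
      then show "m ^ (i + 1) \<le> p" unfolding e using m by (intro power_increasing) auto
    qed (use \<open>j \<le> m ^ (i + 1)\<close> in simp)
    then show ?thesis by (metis (mono_tags, lifting) filter_mset_cong)
  qed
  show ?thesis
    unfolding conjugate_def range using image_mset_power_blocks[of m n ?N] const m all by simp
qed

section \<open>The staircase partition\<close>

definition staircase :: "nat \<Rightarrow> nat \<Rightarrow> nat \<Rightarrow> nat multiset" where
  "staircase m c k = {#m ^ (c + k + 1)#}
    + (\<Sum>i<c. replicate_mset (m ^ (i + 1) - m ^ i) (m ^ (c - i)))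
    + replicate_mset (m ^ (c + k + 1) - m ^ c) 1"

lemma in_sum_multisetD: "p \<in># (\<Sum>i<n. f i) \<Longrightarrow> \<exists>i<(n::nat). p \<in># f i"
  by (induction n) (auto simp: less_Suc_eq)

lemma size_filter_sum: "size (filter_mset P (\<Sum>i<(n::nat). f i)) = (\<Sum>i<n. size (filter_mset P (f i)))"
  by (induction n) simp_all

lemma staircase_parts:
  assumes "p \<in># staircase m c k"
  shows "\<exists>i\<le>c + k + 1. p = m ^ i"
proof -
  have "p = m ^ (c + k + 1) \<or> (\<exists>i<c. p = m ^ (c - i)) \<or> p = m ^ 0"
    using assms unfolding staircase_def
    by (auto dest!: in_sum_multisetD split: if_splits simp: in_replicate_mset)
  moreover have "c - i \<le> c + k + 1" for i by simp
  ultimately show ?thesis by blast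
qed

text \<open>The multiplicities of the middle blocks are chosen to telescope to a power. The truncated
  exponent makes the formula give 1 for \<open>i > c + 1\<close>, where only the largest part is counted.\<close>

lemma staircase_count_ge:
  assumes m: "m \<ge> 2"
    and i: "1 \<le> i" "i \<le> c + k + 1"
  shows "size {#p \<in># staircase m c k. m ^ i \<le> p#} = m ^ (c + 1 - i)"
proof -
  have one: "\<not> m ^ i \<le> 1" using one_less_power[of m i] m i(1) by linarith
  have top: "m ^ i \<le> m ^ (c + k + 1)" using m i(2) by (intro power_increasing) auto
  have "(\<Sum>j<c. size {#p \<in># replicate_mset (m ^ (j + 1) - m ^ j) (m ^ (c - j)). m ^ i \<le> p#})
      = (\<Sum>j<c. if j < c + 1 - i then m ^ (j + 1) - m ^ j else 0)"
  proof (rule sum.cong)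
    fix j assume "j \<in> {..<c}"
    then have "m ^ i \<le> m ^ (c - j) \<longleftrightarrow> j < c + 1 - i" using m i(1) by auto
    then show "size {#p \<in># replicate_mset (m ^ (j + 1) - m ^ j) (m ^ (c - j)). m ^ i \<le> p#}
      = (if j < c + 1 - i then m ^ (j + 1) - m ^ j else 0)"
      by (simp add: filter_replicate_mset_if)
  qed simp
  also have "\<dots> = (\<Sum>j<c + 1 - i. m ^ (j + 1) - m ^ j)"
    using i(1) by (intro sum.mono_neutral_cong_right) auto
  also have "\<dots> = m ^ (c + 1 - i) - 1"
    using sum_power_diff_telescope[of m 0 "c + 1 - i"] m by simp
  finally have "size {#p \<in># staircase m c k. m ^ i \<le> p#} = 1 + (m ^ (c + 1 - i) - 1)"
    unfolding staircase_def filter_union_mset size_union size_filter_sum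
    using one top by (simp add: filter_replicate_mset_if)
  then show ?thesis using m by simp
qed

lemma size_staircase:
  assumes m: "m \<ge> 2"
  shows "size (staircase m c k) = m ^ (c + k + 1)"
proof -
  have "size (\<Sum>i<c. replicate_mset (m ^ (i + 1) - m ^ i) (m ^ (c - i)))
      = (\<Sum>i<c. m ^ (i + 1) - m ^ i)"
    using size_filter_sum[of "\<lambda>_. True" "\<lambda>i. replicate_mset (m ^ (i + 1) - m ^ i) (m ^ (c - i))" c]
    by simp
  also have "\<dots> = m ^ c - 1"
    using sum_power_diff_telescope[of m 0 c] m by simp
  finally have "size (staircase m c k) = 1 + (m ^ c - 1) + (m ^ (c + k + 1) - m ^ c)"
    unfolding staircase_def by simp
  moreover have "1 \<le> m ^ c" "m ^ c \<le> m ^ (c + k + 1)"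
    using m by (auto intro!: power_increasing simp del: power_Suc)
  ultimately show ?thesis by simp
qed

text \<open>For the exponents \<open>i < c\<close> the blocks of the conjugate are literally the middle blocks; for
  \<open>c \<le> i \<le> c + k\<close> they consist of ones, and their multiplicities telescope to the number of ones.\<close>

lemma conjugate_staircase:
  assumes m: "m \<ge> 2"
  shows "conjugate (staircase m c k) = staircase m c k"
proof -
  let ?b = "\<lambda>i. replicate_mset (m ^ (i + 1) - m ^ i) (m ^ (c - i))"
  have top: "m ^ (c + k + 1) \<in># staircase m c k" by (simp add: staircase_def)
  have split: "(\<Sum>i<c + d. ?b i) = (\<Sum>i<c. ?b i) + (\<Sum>i<d. ?b (c + i))" for d
    by (induction d) (simp_all add: add.assoc)
  have "conjugate (staircase m c k) = {#m ^ (c + k + 1)#} + (\<Sum>i<c + k + 1.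
      replicate_mset (m ^ (i + 1) - m ^ i) (size {#p \<in># staircase m c k. m ^ (i + 1) \<le> p#}))"
    by (simp only: conjugate_powers[OF m staircase_parts top] size_staircase[OF m])
  also have "(\<Sum>i<c + k + 1.
      replicate_mset (m ^ (i + 1) - m ^ i) (size {#p \<in># staircase m c k. m ^ (i + 1) \<le> p#}))
    = (\<Sum>i<c + (k + 1). ?b i)"
  proof (rule sum.cong)
    fix i assume "i \<in> {..<c + (k + 1)}"
    then have "size {#p \<in># staircase m c k. m ^ (i + 1) \<le> p#} = m ^ (c - i)"
      using staircase_count_ge[OF m, of "i + 1" c k] by simp
    then show "replicate_mset (m ^ (i + 1) - m ^ i)
        (size {#p \<in># staircase m c k. m ^ (i + 1) \<le> p#}) = ?b i" by simp
  qed simp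
  also have "\<dots> = (\<Sum>i<c. ?b i) + (\<Sum>i<k + 1. ?b (c + i))"
    by (rule split)
  also have "(\<Sum>i<k + 1. ?b (c + i)) = replicate_mset (m ^ (c + k + 1) - m ^ c) 1"
    using sum_replicate_mset[of "\<lambda>i. m ^ (c + i + 1) - m ^ (c + i)" "1::nat" "k + 1"]
      sum_power_diff_telescope[of m c "k + 1"] m by (simp add: add.assoc)
  finally show ?thesis unfolding staircase_def by (simp add: add.assoc)
qed

lemma CMP_staircase:
  assumes m: "m \<ge> 2"
  shows "CMP m (staircase m c k)"
proof -
  have "0 \<notin># staircase m c k"
    using staircase_parts[of 0 m c k] m by auto
  moreover have "staircase m c k \<noteq> {#}" by (simp add: staircase_def)
  ultimately have "m_ary m (staircase m c k)"
    using staircase_parts[of _ m c k] unfolding m_ary_def is_partition_def by blast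
  then show ?thesis by (simp add: CMP_def conjugate_staircase[OF m])
qed

lemma sum_mset_sum: "sum_mset (\<Sum>i<(n::nat). f i) = (\<Sum>i<n. sum_mset (f i))"
  by (induction n) simp_all

lemma sum_mset_staircase:
  assumes m: "m \<ge> 2"
  shows "sum_mset (staircase m c k) + m ^ c = 2 * m ^ (c + k + 1) + c * ((m - 1) * m ^ c)"
proof -
  have "(m ^ (i + 1) - m ^ i) * m ^ (c - i) = (m - 1) * m ^ c" if "i < c" for i
  proof -
    have "m ^ (i + 1) - m ^ i = (m - 1) * m ^ i" by (simp add: diff_mult_distrib)
    then show ?thesis using that by (simp add: power_add[symmetric])
  qed
  then have "(\<Sum>i<c. (m ^ (i + 1) - m ^ i) * m ^ (c - i)) = c * ((m - 1) * m ^ c)"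
    by simp
  moreover have "m ^ c \<le> m ^ (c + k + 1)" using m by (intro power_increasing) auto
  ultimately show ?thesis unfolding staircase_def by (simp add: sum_mset_sum)
qed

section \<open>Tracing the operators\<close>

lemma raise_iterate:
  assumes m: "m \<ge> 2"
  shows "(raise m ^^ k) (of_mults m [1]) = of_mults m [m ^ k]"
proof (induction k)
  case (Suc k)
  then show ?case using raise_of_mults[OF m, of "m ^ k" "[]"] m by simp
qed simp

text \<open>Multiplying the multiplicities \<open>m ^ (j + 1) - m ^ j\<close> by \<open>m\<close> shifts them by one place, and the
  leading 1, raised to \<open>m\<close>, splits into \<open>1\<close> and the missing entry \<open>m - 1\<close>.\<close>

lemma migrate_raise_iterate:
  assumes m: "m \<ge> 2" and a: "a \<noteq> 0"
  shows "((migrate m \<circ> raise m) ^^ Suc c) (of_mults m [a])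
    = of_mults m (1 # map (\<lambda>j. m ^ (j + 1) - m ^ j) [0..<c] @ [m ^ c * (m * a - 1)])"
proof (induction c)
  case 0
  then show ?case
    using raise_of_mults[OF m a, of "[]"] migrate_of_mults[OF m, of "m * a" "[]"] m a by simp
next
  case (Suc c)
  let ?d = "\<lambda>j. m ^ (j + 1) - m ^ j"
  let ?t = "map ?d [0..<c] @ [m ^ c * (m * a - 1)]"
  have shift: "map ?d [0..<Suc c] = (m - 1) # map (\<lambda>j. m * ?d j) [0..<c]"
    by (simp add: map_upt_Suc diff_mult_distrib2 del: upt_Suc)
  have "((migrate m \<circ> raise m) ^^ Suc (Suc c)) (of_mults m [a])
      = migrate m (raise m (of_mults m (1 # ?t)))"
    by (subst funpow.simps(2)) (simp only: o_apply Suc.IH[unfolded o_def] Suc.IH)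
  also have "\<dots> = of_mults m (1 # (m - 1) # map (\<lambda>a. m * a) ?t)"
    using raise_of_mults[OF m, of 1 ?t] migrate_of_mults[OF m, of m "map (\<lambda>a. m * a) ?t"] m
    by simp
  also have "(m - 1) # map (\<lambda>a. m * a) ?t = map ?d [0..<Suc c] @ [m ^ Suc c * (m * a - 1)]"
    unfolding shift by (simp add: comp_def mult.assoc)
  finally show ?case .
qed

lemma migrate_iterate:
  assumes m: "m \<ge> 2"
  shows "(migrate m ^^ k) (of_mults m (1 # as)) = of_mults m (1 # replicate k 0 @ as)"
proof (induction k)
  case (Suc k)
  then show ?case using migrate_of_mults[OF m, of 1 "replicate k 0 @ as"] by simp
qed simp

lemma of_mults_replicate_0: "of_mults m (replicate k 0 @ as) = of_mults m as"
  by (induction k) simp_all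

lemma of_mults_map_upt:
  "of_mults m (map f [j..<c] @ [b])
    = (\<Sum>i\<in>{j..<c}. replicate_mset (f i) (m ^ (c - i))) + replicate_mset b 1"
proof (induction "c - j" arbitrary: j)
  case (Suc n)
  then have "j < c" by simp
  then show ?case using Suc(1)[of "Suc j"] Suc(2)
    by (simp add: upt_conv_Cons sum.atLeast_Suc_lessThan Suc_diff_Suc add.assoc)
qed simp

lemma staircase_generated:
  assumes m: "m \<ge> 2"
  shows "(migrate m ^^ k \<circ> (migrate m \<circ> raise m) ^^ Suc c \<circ> raise m ^^ k) (of_mults m [1])
    = staircase m c k"
proof -
  let ?t = "map (\<lambda>j. m ^ (j + 1) - m ^ j) [0..<c] @ [m ^ c * (m * m ^ k - 1)]"
  have "(migrate m ^^ k \<circ> (migrate m \<circ> raise m) ^^ Suc c \<circ> raise m ^^ k) (of_mults m [1])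
      = of_mults m (1 # replicate k 0 @ ?t)"
    unfolding o_apply[of "migrate m ^^ k \<circ> _"] o_apply[of "migrate m ^^ k"] raise_iterate[OF m]
    using m by (subst migrate_raise_iterate[OF m]) (simp_all only: migrate_iterate[OF m], simp)
  also have "\<dots> = {#m ^ (k + length ?t)#} + of_mults m ?t"
    by (simp only: of_mults.simps of_mults_replicate_0 length_append length_replicate) simp
  also have "\<dots> = staircase m c k"
    unfolding of_mults_map_upt staircase_def
    by (simp add: atLeast0LessThan diff_mult_distrib2 power_add algebra_simps)
  finally show ?thesis .
qed

section \<open>The exponent\<close>

lemma exponent_equation:
  fixes m :: nat
  assumes m: "m \<ge> 2"
    and c: "Suc c = m ^ (k + 1) - (\<Sum>i=1..k. m ^ i)"
  shows "2 * m ^ (k + 1) + c * (m - 1) = m ^ (k + 2) + 1"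
proof -
  let ?S = "\<Sum>i=1..k. m ^ i"
  have geometric: "?S * (m - 1) + m = m ^ (k + 1)"
  proof (induction k)
    case (Suc k)
    have "m ^ Suc k * (m - 1) + m ^ (k + 1) = m ^ (Suc k + 1)"
      using m by (cases m) (simp_all add: algebra_simps)
    then show ?case using Suc by (simp add: add_mult_distrib)
  qed simp
  have "Suc c + ?S = m ^ (k + 1)"
    using c sum_powers_less[OF m, of k] by simp
  then have "(Suc c + ?S) * (m - 1) = m ^ (k + 1) * (m - 1)" by simp
  moreover have "m ^ (k + 1) * (m - 1) + m ^ (k + 1) = m ^ (k + 2)"
    using m by (cases m) (simp_all add: algebra_simps)
  ultimately show ?thesis using geometric m by (simp add: add_mult_distrib)
qed

theorem theorem5p2:
  fixes m k B :: nat
  assumes "m \<ge> 2"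
    and "B = m ^ (k + 1) - (\<Sum>i=1..k. m ^ i)"
  shows "let \<mu> = (migrate m ^^ k \<circ> (migrate m \<circ> raise m) ^^ B \<circ> raise m ^^ k) (of_mults m [1])
    in CMP m \<mu> \<and> conjugate \<mu> = \<mu> \<and> partition_of \<mu> (m ^ (B + k + 1))"
proof -
  note m = assms(1)
  have "B > 0" using assms(2) sum_powers_less[OF m, of k] by simp
  then obtain c where B: "B = Suc c" by (cases B) auto
  have eq: "2 * m ^ (k + 1) + c * (m - 1) = m ^ (k + 2) + 1"
    using exponent_equation[OF m] assms(2) B by simp
  have "sum_mset (staircase m c k) + m ^ c = m ^ c * (2 * m ^ (k + 1) + c * (m - 1))"
    using sum_mset_staircase[OF m, of c k] by (simp add: power_add algebra_simps)
  also have "\<dots> = m ^ (B + k + 1) + m ^ c"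
    unfolding eq B by (simp add: power_add algebra_simps)
  finally have "sum_mset (staircase m c k) = m ^ (B + k + 1)" by simp
  then have "partition_of (staircase m c k) (m ^ (B + k + 1))"
    using CMP_staircase[OF m, of c k] by (simp add: partition_of_def CMP_def m_ary_def)
  then show ?thesis
    using CMP_staircase[OF m] conjugate_staircase[OF m] staircase_generated[OF m, of k c]
    unfolding B Let_def by simp
qed

end
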